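(* Let $a=(a_k)_{1\le k\le n}$, $b=(b_k)_{1\le k\le n}$, $c=(c_k)_{1\le k\le n}$ be elements of $\mathrm{Vect}\,\mathbb{C}^{sa}_{\langle n\mid\tau\rangle}$. If $$B(c,a)=\Pi\Big(D_a c_k+\sum_{1\le j\le n} m_{c_j}(\sim\partial_k a_j)\Big)_{1\le k\le n},$$ then $$-\langle\{a,b\},c\rangle=\langle B(c,a),b\rangle ,$$ equivalently, with $[a,b]=-\{a,b\}$, $\langle [a,b],c\rangle=\langle B(c,a),b\rangle$. Moreover, $$B(a,a)=\Pi\,(D_a a_k)_{1\le k\le n}.$$
   Context: Let $n$ be a positive integer and let $(M,\tau)$ be the von Neumann algebra $W^*(s_1,\dots,s_n)$ generated by a semicircular system $s_1,\dots,s_n$ (self-adjoint, freely independent, each with the $(0,1)$ semicircle distribution) with its normal faithful trace state $\tau$. The $s_j$ are algebraically free; $\mathbb{C}_{\langle n\rangle}\subset M$ denotes the $*$-algebra of non-commutative polynomials in $s_1,\dots,s_n$ (generated by $1,s_1,\dots,s_n$). Free difference quotients: $\partial_j:\mathbb{C}_{\langle n\rangle}\to\mathbb{C}_{\langle n\rangle}\otimes\mathbb{C}_{\langle n\rangle}$ is the derivation with $\partial_j s_k=\delta_{jk}1\otimes1$. The flip is $\sim(x\otimes y)=y\otimes x$. For $b\in\mathbb{C}_{\langle n\rangle}$, $m_b:\mathbb{C}_{\langle n\rangle}\otimes\mathbb{C}_{\langle n\rangle}\to\mathbb{C}_{\langle n\rangle}$ is the linear map with $m_b(P\otimes Q)=PbQ$.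 Cyclic derivatives: $\delta_j=\mu\circ\sim\circ\,\partial_j$ with $\mu(x\otimes y)=xy$, i.e. $\delta_j(s_{i_1}\cdots s_{i_m})=\sum_{k:\,i_k=j}s_{i_{k+1}}\cdots s_{i_m}s_{i_1}\cdots s_{i_{k-1}}$. $\mathrm{Vect}\,\mathbb{C}_{\langle n\rangle}=(\mathbb{C}_{\langle n\rangle})^n$. For $P=(P_j)_{1\le j\le n}\in\mathrm{Vect}\,\mathbb{C}_{\langle n\rangle}$, $D_P=\sum_{1\le j\le n}m_{P_j}\circ\partial_j$ is the derivation of $\mathbb{C}_{\langle n\rangle}$ with $D_Ps_j=P_j$. The bracket is $\{P,Q\}=(D_PQ_j-D_QP_j)_{1\le j\le n}$ and the commutator is $[P,Q]=-\{P,Q\}$. The "divergence-free" vector fields are $$\mathrm{Vect}\,\mathbb{C}_{\langle n\mid\tau\rangle}=\Big\{P\in\mathrm{Vect}\,\mathbb{C}_{\langle n\rangle}\;:\;\sum_{1\le j\le n}\tau(P_j\,\delta_jR)=0\ \ \forall R\in\mathbb{C}_{\langle n\rangle}\Big\},$$ and $\mathrm{Vect}\,\mathbb{C}^{sa}_{\langle n\mid\tau\rangle}$ is the set of those $P=(P_j)$ in it with $P_j=P_j^*$ for all $j$; it is a real Lie algebra. The scalar product is $\langle(a_j),(b_j)\rangle=\sum_{1\le j\le n}\tau(a_jb_j)$. $\Pi$ is the orthogonal projection of $(L^2(M,\tau))^n$ onto the closure of $\mathrm{Vect}\,\mathbb{C}_{\langle n\mid\tau\rangle}$ (the analogue of the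 Leray projection). Known fact: $\Pi$ maps $\mathrm{Vect}\,\mathbb{C}_{\langle n\rangle}$ onto $\mathrm{Vect}\,\mathbb{C}_{\langle n\mid\tau\rangle}$ and preserves self-adjointness, so that $B(c,a)\in\mathrm{Vect}\,\mathbb{C}^{sa}_{\langle n\mid\tau\rangle}$. *)

theory Defs
  imports "HOL-Analysis.Analysis" "HOL-Library.Poly_Mapping" "HOL-Computational_Algebra.Polynomial"
begin

section \<open>Complex Hilbert spaces\<close>

text \<open>The scalar product is linear in the first and conjugate-linear in the second variable.\<close>

class complex_hilbert_space = real_inner + banach +
  fixes scaleC :: "complex \<Rightarrow> 'a \<Rightarrow> 'a"  (infixr \<open>*\<^sub>C\<close> 75)
    and cinner :: "'a \<Rightarrow> 'a \<Rightarrow> complex"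
  assumes scaleC_add_right: "c *\<^sub>C (x + y) = c *\<^sub>C x + c *\<^sub>C y"
    and scaleC_add_left: "(c + d) *\<^sub>C x = c *\<^sub>C x + d *\<^sub>C x"
    and scaleC_scaleC: "c *\<^sub>C d *\<^sub>C x = (c * d) *\<^sub>C x"
    and scaleC_of_real: "complex_of_real r *\<^sub>C x = r *\<^sub>R x"
    and cinner_commute: "cinner x y = cnj (cinner y x)"
    and cinner_add_left: "cinner (x + y) z = cinner x z + cinner y z"
    and cinner_scaleC_left: "cinner (c *\<^sub>C x) y = c * cinner x y"
    and inner_eq_Re_cinner: "inner x y = Re (cinner x y)"

instantiation vec :: (complex_hilbert_space, finite) complex_hilbert_space
begin

definition scaleC_vec :: "complex \<Rightarrow> 'a ^ 'b \<Rightarrow> 'a ^ 'b" where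
  "c *\<^sub>C x = (\<chi> i. c *\<^sub>C x $ i)"

definition cinner_vec :: "'a ^ 'b \<Rightarrow> 'a ^ 'b \<Rightarrow> complex" where
  "cinner x y = (\<Sum>i\<in>UNIV. cinner (x $ i) (y $ i))"

instance
proof
  fix x y z :: "'a ^ 'b" and c d :: complex and r :: real
  show "c *\<^sub>C (x + y) = c *\<^sub>C x + c *\<^sub>C y"
    by (simp add: scaleC_vec_def vec_eq_iff scaleC_add_right)
  show "(c + d) *\<^sub>C x = c *\<^sub>C x + d *\<^sub>C x"
    by (simp add: scaleC_vec_def vec_eq_iff scaleC_add_left)
  show "c *\<^sub>C d *\<^sub>C x = (c * d) *\<^sub>C x"
    by (simp add: scaleC_vec_def vec_eq_iff scaleC_scaleC)
  show "complex_of_real r *\<^sub>C x = r *\<^sub>R x"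
    by (simp add: scaleC_vec_def vec_eq_iff scaleC_of_real)
  show "cinner x y = cnj (cinner y x)"
    unfolding cinner_vec_def cnj_sum by (intro sum.cong refl cinner_commute)
  show "cinner (x + y) z = cinner x z + cinner y z"
    by (simp add: cinner_vec_def cinner_add_left sum.distrib)
  show "cinner (c *\<^sub>C x) y = c * cinner x y"
    by (simp add: cinner_vec_def scaleC_vec_def cinner_scaleC_left sum_distrib_left)
  show "inner x y = Re (cinner x y)"
    by (simp add: cinner_vec_def inner_vec_def inner_eq_Re_cinner)
qed

end

definition orth_proj :: "'a::complex_hilbert_space set \<Rightarrow> 'a \<Rightarrow> 'a" where
  "orth_proj S x = (THE y. y \<in> S \<and> (\<forall>z\<in>S. cinner (x - y) z = 0))"


section \<open>Von Neumann algebras and traces\<close>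

definition bounded_clinear :: "('h::complex_hilbert_space \<Rightarrow> 'h) \<Rightarrow> bool" where
  "bounded_clinear T \<longleftrightarrow> bounded_linear T \<and> (\<forall>c x. T (c *\<^sub>C x) = c *\<^sub>C T x)"

definition hadjoint :: "('h::complex_hilbert_space \<Rightarrow> 'h) \<Rightarrow> ('h \<Rightarrow> 'h)" where
  "hadjoint T = (THE S. \<forall>x y. cinner (T x) y = cinner x (S y))"

definition self_adjoint :: "('h::complex_hilbert_space \<Rightarrow> 'h) \<Rightarrow> bool" where
  "self_adjoint T \<longleftrightarrow> (\<forall>x y. cinner (T x) y = cinner x (T y))"

definition commutant :: "('h::complex_hilbert_space \<Rightarrow> 'h) set \<Rightarrow> ('h \<Rightarrow> 'h) set" where
  "commutant S = {T. bounded_clinear T \<and> (\<forall>X\<in>S. T \<circ> X = X \<circ> T)}"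

definition von_neumann_algebra :: "('h::complex_hilbert_space \<Rightarrow> 'h) set \<Rightarrow> bool" where
  "von_neumann_algebra M \<longleftrightarrow>
     (\<forall>T\<in>M. bounded_clinear T \<and> hadjoint T \<in> M) \<and> commutant (commutant M) = M"

definition W_star :: "('h::complex_hilbert_space \<Rightarrow> 'h) set \<Rightarrow> ('h \<Rightarrow> 'h) set" where
  "W_star S = \<Inter> {M. von_neumann_algebra M \<and> S \<subseteq> M}"

definition op_le :: "('h::complex_hilbert_space \<Rightarrow> 'h) \<Rightarrow> ('h \<Rightarrow> 'h) \<Rightarrow> bool" where
  "op_le S T \<longleftrightarrow> (\<forall>x. cinner (T x - S x) x \<in> \<real>\<^sub>\<ge>\<^sub>0)"

definition tracial_state ::
  "('h::complex_hilbert_space \<Rightarrow> 'h) set \<Rightarrow> (('h \<Rightarrow> 'h) \<Rightarrow> complex) \<Rightarrow> bool" where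
  "tracial_state M \<tau> \<longleftrightarrow>
     (\<forall>S\<in>M. \<forall>T\<in>M. \<tau> (\<lambda>x. S x + T x) = \<tau> S + \<tau> T) \<and>
     (\<forall>c. \<forall>T\<in>M. \<tau> (\<lambda>x. c *\<^sub>C T x) = c * \<tau> T) \<and>
     (\<forall>T\<in>M. \<tau> (hadjoint T \<circ> T) \<in> \<real>\<^sub>\<ge>\<^sub>0) \<and>
     \<tau> id = 1 \<and>
     (\<forall>S\<in>M. \<forall>T\<in>M. \<tau> (S \<circ> T) = \<tau> (T \<circ> S))"

definition faithful ::
  "('h::complex_hilbert_space \<Rightarrow> 'h) set \<Rightarrow> (('h \<Rightarrow> 'h) \<Rightarrow> complex) \<Rightarrow> bool" where
  "faithful M \<tau> \<longleftrightarrow> (\<forall>T\<in>M. \<tau> (hadjoint T \<circ> T) = 0 \<longrightarrow> T = (\<lambda>x. 0))"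

text \<open>Normality of a positive functional: it preserves suprema of bounded upward directed
  sets of positive elements.\<close>

definition normal ::
  "('h::complex_hilbert_space \<Rightarrow> 'h) set \<Rightarrow> (('h \<Rightarrow> 'h) \<Rightarrow> complex) \<Rightarrow> bool" where
  "normal M \<tau> \<longleftrightarrow>
     (\<forall>D T. D \<subseteq> M \<and> D \<noteq> {} \<and> (\<forall>A\<in>D. op_le (\<lambda>x. 0) A) \<and>
            (\<forall>A\<in>D. \<forall>B\<in>D. \<exists>C\<in>D. op_le A C \<and> op_le B C) \<and>
            T \<in> M \<and> (\<forall>A\<in>D. op_le A T) \<and>
            (\<forall>T'\<in>M. (\<forall>A\<in>D. op_le A T') \<longrightarrow> op_le T T')
        \<longrightarrow> Re (\<tau> T) = (SUP A\<in>D. Re (\<tau> A)))"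

text \<open>
  \<open>L2_space M \<tau> \<eta>\<close>: the Hilbert space \<open>'k\<close>, with the inclusion \<open>\<eta>\<close> of \<open>M\<close> into it, is
  \<open>L\<^sup>2(M, \<tau>)\<close>, i.e. a completion of \<open>M\<close> for the scalar product \<open>\<tau>(T\<^sup>* S)\<close>. This determines
  \<open>('k, \<eta>)\<close> up to a unique unitary.
\<close>

definition L2_space ::
  "('h::complex_hilbert_space \<Rightarrow> 'h) set \<Rightarrow> (('h \<Rightarrow> 'h) \<Rightarrow> complex) \<Rightarrow>
   (('h \<Rightarrow> 'h) \<Rightarrow> 'k::complex_hilbert_space) \<Rightarrow> bool" where
  "L2_space M \<tau> \<eta> \<longleftrightarrow>
     (\<forall>S\<in>M. \<forall>T\<in>M. \<eta> (\<lambda>x. S x + T x) = \<eta> S + \<eta> T) \<and>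
     (\<forall>c. \<forall>T\<in>M. \<eta> (\<lambda>x. c *\<^sub>C T x) = c *\<^sub>C \<eta> T) \<and>
     (\<forall>S\<in>M. \<forall>T\<in>M. cinner (\<eta> S) (\<eta> T) = \<tau> (hadjoint T \<circ> S)) \<and>
     closure (\<eta> ` M) = UNIV"


section \<open>Semicircular systems\<close>

definition poly_op :: "complex poly \<Rightarrow> ('h::complex_hilbert_space \<Rightarrow> 'h) \<Rightarrow> ('h \<Rightarrow> 'h)" where
  "poly_op p T = (\<lambda>x. \<Sum>i\<le>degree p. coeff p i *\<^sub>C (T ^^ i) x)"

definition freely_independent ::
  "(('h::complex_hilbert_space \<Rightarrow> 'h) \<Rightarrow> complex) \<Rightarrow> ('i \<Rightarrow> ('h \<Rightarrow> 'h) set) \<Rightarrow> bool" where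
  "freely_independent \<tau> A \<longleftrightarrow>
     (\<forall>ps :: ('i \<times> ('h \<Rightarrow> 'h)) list.
        ps \<noteq> [] \<and> distinct_adj (map fst ps) \<and> (\<forall>(i, T)\<in>set ps. T \<in> A i \<and> \<tau> T = 0)
        \<longrightarrow> \<tau> (foldr (\<circ>) (map snd ps) id) = 0)"

text \<open>The law of mean \<open>0\<close> and variance \<open>1\<close>, with density \<open>(2\<pi>)\<^sup>-\<^sup>1 (4 - t\<^sup>2)\<^sup>1\<^sup>/\<^sup>2\<close> on \<open>[-2, 2]\<close>;
  being compactly supported it is determined by its moments.\<close>

definition semicircular ::
  "(('h::complex_hilbert_space \<Rightarrow> 'h) \<Rightarrow> complex) \<Rightarrow> ('h \<Rightarrow> 'h) \<Rightarrow> bool" where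
  "semicircular \<tau> T \<longleftrightarrow> self_adjoint T \<and>
     (\<forall>m. \<tau> (T ^^ m) = complex_of_real (integral {-2..2} (\<lambda>t. t ^ m * (sqrt (4 - t\<^sup>2) / (2 * pi)))))"

definition semicircular_system ::
  "(('h::complex_hilbert_space \<Rightarrow> 'h) \<Rightarrow> complex) \<Rightarrow> ('n \<Rightarrow> 'h \<Rightarrow> 'h) \<Rightarrow> bool" where
  "semicircular_system \<tau> s \<longleftrightarrow>
     (\<forall>j. bounded_clinear (s j) \<and> semicircular \<tau> (s j)) \<and>
     freely_independent \<tau> (\<lambda>j. {poly_op p (s j) | p. True})"


section \<open>Non-commutative polynomials\<close>

datatype 'i free_monoid = Word (letters: "'i list")

instantiation free_monoid :: (type) monoid_add
begin

definition "0 = Word []"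
definition "v + w = Word (letters v @ letters w)"

instance
  by standard (simp_all add: zero_free_monoid_def plus_free_monoid_def)

end

text \<open>
  The monoid algebra of the free monoid is the free unital algebra; multiplication is
  convolution. \<open>A \<otimes> A\<close> for this algebra \<open>A\<close> has the pairs of words as a basis; the
  multiplication inherited from the product monoid is \<open>(P \<otimes> Q) (P' \<otimes> Q') = P P' \<otimes> Q Q'\<close>.
\<close>

type_synonym 'i ncpoly = "'i free_monoid \<Rightarrow>\<^sub>0 complex"
type_synonym 'i nctensor = "('i free_monoid \<times> 'i free_monoid) \<Rightarrow>\<^sub>0 complex"

definition gen :: "'i \<Rightarrow> 'i ncpoly" where
  "gen j = Poly_Mapping.single (Word [j]) 1"

definition tensor :: "'i ncpoly \<Rightarrow> 'i ncpoly \<Rightarrow> 'i nctensor" where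
  "tensor P Q = (\<Sum>u\<in>Poly_Mapping.keys P. \<Sum>v\<in>Poly_Mapping.keys Q.
     Poly_Mapping.single (u, v) (Poly_Mapping.lookup P u * Poly_Mapping.lookup Q v))"

text \<open>
  \<open>evalp s\<close> is the unital homomorphism with \<open>X\<^sub>j \<mapsto> s\<^sub>j\<close>. A semicircular system is algebraically
  free, so it identifies \<open>'n ncpoly\<close> with the algebra of polynomials in the operators \<open>s\<^sub>j\<close>.
\<close>

definition evalp :: "('i \<Rightarrow> 'h::complex_hilbert_space \<Rightarrow> 'h) \<Rightarrow> 'i ncpoly \<Rightarrow> ('h \<Rightarrow> 'h)" where
  "evalp s P = (\<lambda>x. \<Sum>w\<in>Poly_Mapping.keys P.
     Poly_Mapping.lookup P w *\<^sub>C foldr (\<lambda>i. (\<circ>) (s i)) (letters w) id x)"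

text \<open>The explicit formulas for \<open>\<partial>\<^sub>j\<close> (\<open>fdq\<close>), the flip, \<open>m\<^sub>b\<close> (\<open>insert_mult\<close>), \<open>\<mu>\<close> (\<open>mult_map\<close>) and \<open>D\<^sub>P\<close> (\<open>vderiv\<close>)
  are matched with their characterizations in the last section.\<close>

definition fdq :: "'i \<Rightarrow> 'i ncpoly \<Rightarrow> 'i nctensor" where
  "fdq j P = (\<Sum>w\<in>Poly_Mapping.keys P. \<Sum>k | k < length (letters w) \<and> letters w ! k = j.
     Poly_Mapping.single (Word (take k (letters w)), Word (drop (Suc k) (letters w)))
       (Poly_Mapping.lookup P w))"

definition flip :: "'i nctensor \<Rightarrow> 'i nctensor" where
  "flip X = (\<Sum>(u, v)\<in>Poly_Mapping.keys X. Poly_Mapping.single (v, u) (Poly_Mapping.lookup X (u, v)))"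

definition insert_mult :: "'i ncpoly \<Rightarrow> 'i nctensor \<Rightarrow> 'i ncpoly" where
  "insert_mult b X = (\<Sum>(u, v)\<in>Poly_Mapping.keys X.
     Poly_Mapping.single u (Poly_Mapping.lookup X (u, v)) * b * Poly_Mapping.single v 1)"

definition mult_map :: "'i nctensor \<Rightarrow> 'i ncpoly" where
  "mult_map X = (\<Sum>(u, v)\<in>Poly_Mapping.keys X.
     Poly_Mapping.single u (Poly_Mapping.lookup X (u, v)) * Poly_Mapping.single v 1)"

definition cyc_deriv :: "'i \<Rightarrow> 'i ncpoly \<Rightarrow> 'i ncpoly" where
  "cyc_deriv j P = mult_map (flip (fdq j P))"


section \<open>Vector fields\<close>

type_synonym 'n vect = "'n ncpoly ^ 'n"

definition vderiv :: "'n::finite vect \<Rightarrow> 'n ncpoly \<Rightarrow> 'n ncpoly" where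
  "vderiv P R = (\<Sum>j\<in>UNIV. insert_mult (P $ j) (fdq j R))"

definition bracket :: "'n::finite vect \<Rightarrow> 'n vect \<Rightarrow> 'n vect" where
  "bracket P Q = (\<chi> j. vderiv P (Q $ j) - vderiv Q (P $ j))"

definition commutator :: "'n::finite vect \<Rightarrow> 'n vect \<Rightarrow> 'n vect" where
  "commutator P Q = - bracket P Q"

definition Vect_df ::
  "(('h::complex_hilbert_space \<Rightarrow> 'h) \<Rightarrow> complex) \<Rightarrow> ('n::finite \<Rightarrow> 'h \<Rightarrow> 'h) \<Rightarrow> 'n vect set" where
  "Vect_df \<tau> s = {P. \<forall>R. (\<Sum>j\<in>UNIV. \<tau> (evalp s (P $ j * cyc_deriv j R))) = 0}"

definition Vect_df_sa ::
  "(('h::complex_hilbert_space \<Rightarrow> 'h) \<Rightarrow> complex) \<Rightarrow> ('n::finite \<Rightarrow> 'h \<Rightarrow> 'h) \<Rightarrow> 'n vect set" where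
  "Vect_df_sa \<tau> s = {P \<in> Vect_df \<tau> s. \<forall>j. self_adjoint (evalp s (P $ j))}"

definition vscal ::
  "(('h::complex_hilbert_space \<Rightarrow> 'h) \<Rightarrow> complex) \<Rightarrow> ('n::finite \<Rightarrow> 'h \<Rightarrow> 'h) \<Rightarrow>
   'n vect \<Rightarrow> 'n vect \<Rightarrow> complex" where
  "vscal \<tau> s P Q = (\<Sum>j\<in>UNIV. \<tau> (evalp s (P $ j * Q $ j)))"

definition L2_vect ::
  "(('h::complex_hilbert_space \<Rightarrow> 'h) \<Rightarrow> 'k::complex_hilbert_space) \<Rightarrow>
   ('n::finite \<Rightarrow> 'h \<Rightarrow> 'h) \<Rightarrow> 'n vect \<Rightarrow> 'k ^ 'n" where
  "L2_vect \<eta> s P = (\<chi> j. \<eta> (evalp s (P $ j)))"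

definition leray ::
  "(('h::complex_hilbert_space \<Rightarrow> 'h) \<Rightarrow> complex) \<Rightarrow>
   (('h \<Rightarrow> 'h) \<Rightarrow> 'k::complex_hilbert_space) \<Rightarrow> ('n::finite \<Rightarrow> 'h \<Rightarrow> 'h) \<Rightarrow> 'k ^ 'n \<Rightarrow> 'k ^ 'n" where
  "leray \<tau> \<eta> s = orth_proj (closure (L2_vect \<eta> s ` Vect_df \<tau> s))"

text \<open>\<open>B(c, a)\<close> is taken in \<open>L\<^sup>2(M, \<tau>)\<^sup>n\<close>, where \<open>\<Pi>\<close> (\<open>leray\<close>) has its values.\<close>

definition euler_B ::
  "(('h::complex_hilbert_space \<Rightarrow> 'h) \<Rightarrow> complex) \<Rightarrow>
   (('h \<Rightarrow> 'h) \<Rightarrow> 'k::complex_hilbert_space) \<Rightarrow> ('n::finite \<Rightarrow> 'h \<Rightarrow> 'h) \<Rightarrow>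
   'n vect \<Rightarrow> 'n vect \<Rightarrow> 'k ^ 'n" where
  "euler_B \<tau> \<eta> s c a = leray \<tau> \<eta> s (L2_vect \<eta> s
     (\<chi> k. vderiv a (c $ k) + (\<Sum>j\<in>UNIV. insert_mult (c $ j) (flip (fdq k (a $ j))))))"

section \<open>The defining properties of the operations\<close>

lemma pm_sum_single: "P = (\<Sum>k\<in>Poly_Mapping.keys P. Poly_Mapping.single k (Poly_Mapping.lookup P k))"
proof (rule poly_mapping_eqI)
  fix k
  show "Poly_Mapping.lookup P k =
    Poly_Mapping.lookup (\<Sum>k\<in>Poly_Mapping.keys P. Poly_Mapping.single k (Poly_Mapping.lookup P k)) k"
    by (simp add: lookup_sum lookup_single when_def not_in_keys_iff_lookup_eq_zero)
qed

lemma pm_induct [case_names single add]: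
  fixes P :: "'a \<Rightarrow>\<^sub>0 'b::comm_monoid_add"
  assumes single: "\<And>k c. Q (Poly_Mapping.single k c)"
    and add: "\<And>x y. Q x \<Longrightarrow> Q y \<Longrightarrow> Q (x + y)"
  shows "Q P"
proof -
  have "Q (\<Sum>k\<in>A. Poly_Mapping.single k (Poly_Mapping.lookup P k))" if "finite A" for A
    using that
  proof induction
    case empty
    show ?case using single[of undefined 0] by simp
  next
    case (insert k A)
    then show ?case using single add by simp
  qed
  from this[OF finite_keys[of P]] show ?thesis
    by (simp only: pm_sum_single[symmetric])
qed

lemma fdq_single:
  "fdq j (Poly_Mapping.single w c) = (\<Sum>k | k < length (letters w) \<and> letters w ! k = j.
     Poly_Mapping.single (Word (take k (letters w)), Word (drop (Suc k) (letters w))) c)"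
  by (cases "c = 0") (simp_all add: fdq_def)

lemma fdq_add: "fdq j (P + Q) = fdq j P + fdq j Q"
  unfolding fdq_def
  by (rule setsum_keys_plus_distrib) (simp_all add: single_add sum.distrib)

lemma flip_single: "flip (Poly_Mapping.single (u, v) c) = Poly_Mapping.single (v, u) c"
  by (cases "c = 0") (simp_all add: flip_def)

lemma flip_add: "flip (X + Y) = flip X + flip Y"
  unfolding flip_def case_prod_beta prod.collapse
  by (rule setsum_keys_plus_distrib) (simp_all add: single_add)

lemma insert_mult_single: "insert_mult b (Poly_Mapping.single (u, v) c) =
    Poly_Mapping.single u c * b * Poly_Mapping.single v 1"
  by (cases "c = 0") (simp_all add: insert_mult_def)

lemma insert_mult_add: "insert_mult b (X + Y) = insert_mult b X + insert_mult b Y"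
  unfolding insert_mult_def case_prod_beta prod.collapse
  by (rule setsum_keys_plus_distrib) (simp_all add: single_add distrib_right)

lemma mult_map_single: "mult_map (Poly_Mapping.single (u, v) c) = Poly_Mapping.single (u + v) c"
  by (cases "c = 0") (simp_all add: mult_map_def mult_single)

lemma mult_map_add: "mult_map (X + Y) = mult_map X + mult_map Y"
  unfolding mult_map_def case_prod_beta prod.collapse
  by (rule setsum_keys_plus_distrib) (simp_all add: single_add distrib_right)

lemma tensor_single:
  "tensor (Poly_Mapping.single u c) (Poly_Mapping.single v d) = Poly_Mapping.single (u, v) (c * d)"
  by (cases "c = 0"; cases "d = 0") (simp_all add: tensor_def)

lemma tensor_add_left: "tensor (P + P') Q = tensor P Q + tensor P' Q"
  unfolding tensor_def
  by (rule setsum_keys_plus_distrib) (simp_all add: single_add distrib_right sum.distrib)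

lemma tensor_swap: "tensor P Q = (\<Sum>v\<in>Poly_Mapping.keys Q. \<Sum>u\<in>Poly_Mapping.keys P.
    Poly_Mapping.single (u, v) (Poly_Mapping.lookup P u * Poly_Mapping.lookup Q v))"
  unfolding tensor_def by (rule sum.swap)

lemma tensor_add_right: "tensor P (Q + Q') = tensor P Q + tensor P Q'"
  unfolding tensor_swap
  by (rule setsum_keys_plus_distrib) (simp_all add: single_add distrib_left sum.distrib)

lemma flip_tensor: "flip (tensor P Q) = tensor Q P"
proof (induction P rule: pm_induct)
  case (single u c)
  show ?case
    by (induction Q rule: pm_induct)
      (simp_all add: tensor_single flip_single tensor_add_left tensor_add_right flip_add mult.commute)
qed (simp add: tensor_add_left tensor_add_right flip_add)

lemma insert_mult_tensor: "insert_mult b (tensor P Q) = P * b * Q"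
proof (induction P rule: pm_induct)
  case (single u c)
  show ?case
  proof (induction Q rule: pm_induct)
    case (single v d)
    have comm: "Poly_Mapping.single 0 d * b = b * Poly_Mapping.single 0 d"
    proof (induction b rule: pm_induct)
      case (single w e)
      show ?case by (simp add: mult_single mult.commute)
    qed (simp add: distrib_left distrib_right)
    have "insert_mult b (tensor (Poly_Mapping.single u c) (Poly_Mapping.single v d)) =
        Poly_Mapping.single u (c * d) * b * Poly_Mapping.single v 1"
      by (simp add: tensor_single insert_mult_single)
    also have "Poly_Mapping.single u (c * d) = Poly_Mapping.single u c * Poly_Mapping.single 0 d"
      by (simp add: mult_single)
    also have "\<dots> * b * Poly_Mapping.single v 1 =
        Poly_Mapping.single u c * (Poly_Mapping.single 0 d * b) * Poly_Mapping.single v 1"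
      by (simp only: mult.assoc)
    also have "\<dots> = Poly_Mapping.single u c * b * (Poly_Mapping.single 0 d * Poly_Mapping.single v 1)"
      by (simp only: comm mult.assoc)
    also have "Poly_Mapping.single 0 d * Poly_Mapping.single v 1 = Poly_Mapping.single v d"
      by (simp add: mult_single)
    finally show ?case .
  qed (simp add: tensor_add_right insert_mult_add distrib_left)
qed (simp add: tensor_add_left insert_mult_add distrib_right)

lemma mult_map_tensor: "mult_map (tensor P Q) = P * Q"
proof (induction P rule: pm_induct)
  case (single u c)
  show ?case
    by (induction Q rule: pm_induct)
      (simp_all add: tensor_single mult_map_single tensor_add_right mult_map_add mult_single distrib_left)
qed (simp add: tensor_add_left mult_map_add distrib_right)

lemma fdq_gen: "fdq j (gen k) = (if j = k then tensor 1 1 else 0)"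
proof -
  have 1: "(1 :: 'a ncpoly) = Poly_Mapping.single (Word []) 1"
    by (simp flip: single_one add: zero_free_monoid_def)
  have 2: "{i. i = 0 \<and> [k] ! i = j} = (if j = k then {0} else {})"
    by auto
  show ?thesis
    by (simp add: gen_def fdq_single tensor_single 1 2 cong: conj_cong)
qed

lemma fdq_mult: "fdq j (P * Q) = tensor P 1 * fdq j Q + fdq j P * tensor 1 Q"
proof (induction P rule: pm_induct)
  case (single u c)
  show ?case
  proof (induction Q rule: pm_induct)
    case (single v d)
    obtain x where x: "u = Word x" by (cases u)
    obtain y where y: "v = Word y" by (cases v)
    have one: "(1 :: 'a ncpoly) = Poly_Mapping.single (Word []) 1"
      by (simp flip: single_one add: zero_free_monoid_def)
    let ?f = "\<lambda>k. Poly_Mapping.single (Word (take k (x @ y)), Word (drop (Suc k) (x @ y))) (c * d)"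
    have split: "{k. k < length (x @ y) \<and> (x @ y) ! k = j} =
        {k. k < length x \<and> x ! k = j} \<union> (\<lambda>k. length x + k) ` {k. k < length y \<and> y ! k = j}"
      (is "?A = ?B \<union> ?h ` ?C")
    proof (intro set_eqI iffI)
      fix k assume k: "k \<in> ?A"
      show "k \<in> ?B \<union> ?h ` ?C"
      proof (cases "k < length x")
        case True
        with k show ?thesis by (simp add: nth_append)
      next
        case False
        with k have "k = ?h (k - length x)" "k - length x \<in> ?C"
          by (auto simp: nth_append)
        then show ?thesis by blast
      qed
    qed (auto simp: nth_append)
    have "fdq j (Poly_Mapping.single u c * Poly_Mapping.single v d) = sum ?f ?A"
      by (simp add: mult_single fdq_single x y plus_free_monoid_def)
    also have "\<dots> = sum ?f ?B + sum ?f (?h ` ?C)"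
      unfolding split by (rule sum.union_disjoint) auto
    also have "sum ?f (?h ` ?C) = (\<Sum>k\<in>?C. ?f (?h k))"
      by (subst sum.reindex) auto
    also have "\<dots> = tensor (Poly_Mapping.single u c) 1 * fdq j (Poly_Mapping.single v d)"
      by (simp add: one tensor_single fdq_single x y sum_distrib_left mult_single plus_free_monoid_def)
    also have "sum ?f ?B = fdq j (Poly_Mapping.single u c) * tensor 1 (Poly_Mapping.single v d)"
      by (auto simp add: one tensor_single fdq_single x y sum_distrib_right mult_single
          plus_free_monoid_def intro!: sum.cong)
    finally show ?case by simp
  qed (simp add: distrib_left fdq_add tensor_add_right ac_simps)
qed (simp add: distrib_right fdq_add tensor_add_left ac_simps)

lemma insert_mult_bimodule:
  "insert_mult b (tensor P 1 * X * tensor 1 Q) = P * insert_mult b X * Q"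
proof (induction X rule: pm_induct)
  case (single w c)
  obtain u v where w: "w = (u, v)" by (cases w)
  have "tensor P 1 * tensor (Poly_Mapping.single u c) (Poly_Mapping.single v 1) =
      tensor (P * Poly_Mapping.single u c) (Poly_Mapping.single v 1)"
  proof (induction P rule: pm_induct)
    case (single p e)
    show ?case
      by (simp flip: single_one add: tensor_single mult_single)
  qed (simp add: tensor_add_left distrib_right)
  moreover have "tensor R (Poly_Mapping.single v 1) * tensor 1 Q = tensor R (Poly_Mapping.single v 1 * Q)" for R
  proof (induction R rule: pm_induct)
    case (single r e)
    show ?case
      by (induction Q rule: pm_induct)
        (simp_all flip: single_one add: tensor_single mult_single tensor_add_right distrib_left)
  qed (simp add: tensor_add_left distrib_right)
  moreover have eq: "Poly_Mapping.single w c = tensor (Poly_Mapping.single u c) (Poly_Mapping.single v 1)"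
    by (simp add: tensor_single w)
  ultimately have "tensor P 1 * Poly_Mapping.single w c * tensor 1 Q =
      tensor (P * Poly_Mapping.single u c) (Poly_Mapping.single v 1 * Q)"
    by (simp only:)
  then show ?case
    unfolding eq by (simp only: insert_mult_tensor mult.assoc)
qed (simp add: insert_mult_add distrib_left distrib_right)

lemma vderiv_add: "vderiv P (R + S) = vderiv P R + vderiv P S"
  by (simp add: vderiv_def fdq_add insert_mult_add sum.distrib)

lemma vderiv_mult:
  fixes P :: "'n::finite vect"
  shows "vderiv P (R * S) = R * vderiv P S + vderiv P R * S"
proof -
  have one: "tensor 1 1 = (1 :: 'n nctensor)"
    by (simp flip: single_one add: tensor_single zero_prod_def)
  have "insert_mult b (tensor R 1 * X) = R * insert_mult b X"
    "insert_mult b (X * tensor 1 S) = insert_mult b X * S" for b X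
    using insert_mult_bimodule[of b R X 1] insert_mult_bimodule[of b 1 X S] by (simp_all add: one)
  then show ?thesis
    by (simp add: vderiv_def fdq_mult insert_mult_add sum.distrib sum_distrib_left sum_distrib_right)
qed

lemma vderiv_gen:
  fixes P :: "'n::finite vect"
  shows "vderiv P (gen k) = P $ k"
proof -
  have "insert_mult b (0 :: 'n nctensor) = 0" for b
    by (simp add: insert_mult_def)
  then have "insert_mult (P $ j) (fdq j (gen k)) = (if j = k then P $ k else 0)" for j
    by (simp add: fdq_gen insert_mult_tensor)
  then show ?thesis
    by (simp add: vderiv_def)
qed

lemma cyc_deriv_word:
  "cyc_deriv j (Poly_Mapping.single (Word w) c) = (\<Sum>k | k < length w \<and> w ! k = j.
     Poly_Mapping.single (Word (drop (Suc k) w @ take k w)) c)"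
proof -
  have "mult_map (flip (sum f A)) = (\<Sum>k\<in>A. mult_map (flip (f k)))" if "finite A"
    for f :: "nat \<Rightarrow> 'a nctensor" and A
    using that
  proof induction
    case empty
    show ?case by (simp add: flip_def mult_map_def)
  qed (simp add: flip_add mult_map_add)
  then show ?thesis
    by (simp add: cyc_deriv_def fdq_single flip_single mult_map_single plus_free_monoid_def)
qed

lemma scaleC_zero_left: "0 *\<^sub>C x = 0"
  using scaleC_of_real[of 0 x] by simp

lemma scaleC_one: "1 *\<^sub>C x = x"
  using scaleC_of_real[of 1 x] by simp

lemma scaleC_zero_right: "c *\<^sub>C 0 = 0"
  using scaleC_add_right[of c 0 0] by simp

lemma evalp_single:
  "evalp s (Poly_Mapping.single w c) x = c *\<^sub>C foldr (\<lambda>i. (\<circ>) (s i)) (letters w) id x"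
  by (cases "c = 0") (simp_all add: evalp_def scaleC_zero_left)

lemma evalp_add: "evalp s (P + Q) x = evalp s P x + evalp s Q x"
  unfolding evalp_def
  by (rule setsum_keys_plus_distrib) (simp_all add: scaleC_zero_left scaleC_add_left)

lemma evalp_one: "evalp s 1 = id"
  by (rule ext) (simp flip: single_one add: evalp_single zero_free_monoid_def scaleC_one)

lemma evalp_gen: "evalp s (gen j) = s j"
  by (rule ext) (simp add: gen_def evalp_single scaleC_one)

lemma bounded_clinear_add: "bounded_clinear T \<Longrightarrow> T (x + y) = T x + T y"
  by (simp add: bounded_clinear_def bounded_linear.linear linear_add)

lemma bounded_clinear_scaleC: "bounded_clinear T \<Longrightarrow> T (c *\<^sub>C x) = c *\<^sub>C T x"
  by (simp add: bounded_clinear_def)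

lemma evalp_mult:
  assumes s: "\<And>j. bounded_clinear (s j)"
  shows "evalp s (P * Q) = evalp s P \<circ> evalp s Q"
proof (rule ext)
  fix x
  have clin: "foldr (\<lambda>i. (\<circ>) (s i)) w id (y + z) =
        foldr (\<lambda>i. (\<circ>) (s i)) w id y + foldr (\<lambda>i. (\<circ>) (s i)) w id z"
      "foldr (\<lambda>i. (\<circ>) (s i)) w id (c *\<^sub>C y) = c *\<^sub>C foldr (\<lambda>i. (\<circ>) (s i)) w id y" for w c y z
    by (induction w) (simp_all add: bounded_clinear_add[OF s] bounded_clinear_scaleC[OF s])
  have app: "foldr (\<lambda>i. (\<circ>) (s i)) (u @ v) id y =
      foldr (\<lambda>i. (\<circ>) (s i)) u id (foldr (\<lambda>i. (\<circ>) (s i)) v id y)" for u v y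
    by (induction u) simp_all
  show "evalp s (P * Q) x = (evalp s P \<circ> evalp s Q) x"
  proof (induction P rule: pm_induct)
    case (single u c)
    show ?case
      by (induction Q rule: pm_induct)
        (simp_all add: mult_single evalp_single evalp_add plus_free_monoid_def app clin
          scaleC_scaleC distrib_left scaleC_add_right del: foldr_append)
  qed (simp add: distrib_right evalp_add)
qed

text \<open>On self-adjoint vector fields the scalar product is that of \<open>L\<^sup>2(M, \<tau>)\<^sup>n\<close>.\<close>

lemma commutant_evalp:
  assumes "\<And>j. bounded_clinear (s j)" "T \<in> commutant (range s)"
  shows "T \<circ> evalp s P = evalp s P \<circ> T"
proof (rule ext)
  fix x
  have T: "bounded_clinear T" "\<And>j x. T (s j x) = s j (T x)"
    using assms(2) by (auto simp: commutant_def fun_eq_iff)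
  have "T (foldr (\<lambda>i. (\<circ>) (s i)) w id x) = foldr (\<lambda>i. (\<circ>) (s i)) w id (T x)" for w
    by (induction w) (simp_all add: T(2))
  then show "(T \<circ> evalp s P) x = (evalp s P \<circ> T) x"
    by (induction P rule: pm_induct)
      (simp_all add: evalp_single evalp_add bounded_clinear_add[OF T(1)] bounded_clinear_scaleC[OF T(1)])
qed

lemma bounded_linear_scaleC: "bounded_linear (\<lambda>x. c *\<^sub>C x)"
proof (rule bounded_linear_intro[where K = "cmod c"])
  fix x y :: 'a and r :: real
  show "c *\<^sub>C (x + y) = c *\<^sub>C x + c *\<^sub>C y" by (rule scaleC_add_right)
  show "c *\<^sub>C r *\<^sub>R x = r *\<^sub>R c *\<^sub>C x"
    by (simp flip: scaleC_of_real add: scaleC_scaleC mult.commute)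
  have r: "cinner (c *\<^sub>C x) (c *\<^sub>C x) = c * cnj c * cinner x x"
    by (metis (no_types, opaque_lifting) cinner_commute cinner_scaleC_left complex_cnj_mult mult.assoc)
  have "(norm (c *\<^sub>C x))\<^sup>2 = Re (c * cnj c * cinner x x)"
    by (simp only: power2_norm_eq_inner inner_eq_Re_cinner r)
  also have "\<dots> = (cmod c)\<^sup>2 * inner x x"
    by (simp add: inner_eq_Re_cinner[of x x] complex_mult_cnj cmod_power2 flip: of_real_power of_real_add)
  also have "\<dots> = (norm x * cmod c)\<^sup>2"
    by (simp add: power_mult_distrib power2_norm_eq_inner[of x])
  finally have "(norm (c *\<^sub>C x))\<^sup>2 = (norm x * cmod c)\<^sup>2" .
  then show "norm (c *\<^sub>C x) \<le> norm x * cmod c" by simp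
qed

lemma bounded_clinear_evalp:
  assumes s: "\<And>j. bounded_clinear (s j)"
  shows "bounded_clinear (evalp s P)"
proof -
  have w: "bounded_clinear (foldr (\<lambda>i. (\<circ>) (s i)) w id)" for w
  proof (induction w)
    case Nil
    show ?case by (simp add: bounded_clinear_def bounded_linear_ident id_def)
  next
    case (Cons i w)
    then show ?case using s[of i]
      by (auto simp: bounded_clinear_def comp_def intro: bounded_linear_compose)
  qed
  show ?thesis
  proof (induction P rule: pm_induct)
    case (single u c)
    have "evalp s (Poly_Mapping.single u c) = (\<lambda>x. c *\<^sub>C foldr (\<lambda>i. (\<circ>) (s i)) (letters u) id x)"
      by (rule ext) (rule evalp_single)
    then show ?case using w[of "letters u"]
      by (auto simp: bounded_clinear_def scaleC_scaleC mult.commute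
          intro: bounded_linear_compose[OF bounded_linear_scaleC])
  next
    case (add P Q)
    have "evalp s (P + Q) = (\<lambda>x. evalp s P x + evalp s Q x)"
      by (rule ext) (rule evalp_add)
    then show ?case using add
      by (auto simp: bounded_clinear_def scaleC_add_right intro: bounded_linear_add)
  qed
qed

lemma evalp_in_W_star:
  assumes s: "\<And>j. bounded_clinear (s j)"
  shows "evalp s P \<in> W_star (range s)"
proof -
  have "evalp s P \<in> N" if N: "von_neumann_algebra N" "range s \<subseteq> N" for N
  proof -
    have "evalp s P \<in> commutant (commutant N)"
    proof -
      have "T \<circ> evalp s P = evalp s P \<circ> T" if "T \<in> commutant N" for T
        using that N(2) by (intro commutant_evalp s) (auto simp: commutant_def)
      then show ?thesis
        using bounded_clinear_evalp[OF s] by (auto simp: commutant_def[of "commutant N"])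
    qed
    then show ?thesis using N(1) by (simp add: von_neumann_algebra_def)
  qed
  then show ?thesis by (auto simp: W_star_def)
qed

lemma hadjoint_self_adjoint:
  assumes "self_adjoint T"
  shows "hadjoint T = T"
  unfolding hadjoint_def
proof (rule the_equality)
  show "\<forall>x y. cinner (T x) y = cinner x (T y)"
    using assms by (simp add: self_adjoint_def)
next
  fix S assume S: "\<forall>x y. cinner (T x) y = cinner x (S y)"
  show "S = T"
  proof (rule ext)
    fix y
    have "cinner x (S y) = cinner x (T y)" for x
      using S assms by (metis self_adjoint_def)
    then have "inner x (S y) = inner x (T y)" for x
      by (simp add: inner_eq_Re_cinner)
    then show "S y = T y"
      by (metis vector_eq_ldot)
  qed
qed

lemma cinner_L2_vect:
  assumes "M = W_star (range s)" "tracial_state M \<tau>" "semicircular_system \<tau> s" "L2_space M \<tau> \<eta>"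
    and "\<And>j. self_adjoint (evalp s (b $ j))"
  shows "cinner (L2_vect \<eta> s a) (L2_vect \<eta> s b) = vscal \<tau> s a b"
proof -
  have s: "bounded_clinear (s j)" for j
    using assms(3) by (simp add: semicircular_system_def)
  note [simp] = evalp_in_W_star[of s, OF s]
  have "cinner (\<eta> (evalp s (a $ j))) (\<eta> (evalp s (b $ j))) = \<tau> (evalp s (a $ j * b $ j))" for j
  proof -
    have "cinner (\<eta> (evalp s (a $ j))) (\<eta> (evalp s (b $ j))) =
        \<tau> (evalp s (b $ j) \<circ> evalp s (a $ j))"
      using assms(1,4,5) by (simp add: L2_space_def hadjoint_self_adjoint)
    also have "\<dots> = \<tau> (evalp s (a $ j) \<circ> evalp s (b $ j))"
      using assms(1,2) unfolding tracial_state_def by simp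
    finally show ?thesis by (simp add: evalp_mult[of s, OF s])
  qed
  then show ?thesis
    by (simp add: cinner_vec_def L2_vect_def vscal_def)
qed

end

theory Submission
  imports Defs
begin

text \<open>
  Write \<open>t\<close> for the trace of a polynomial evaluated at the \<open>s\<^sub>j\<close>; it is an additive functional on
  the free algebra with \<open>t(PQ) = t(QP)\<close>. Let \<open>V\<^sub>k = D\<^sub>a c\<^sub>k + \<Sum>\<^sub>j m(c\<^sub>j)(\<sim>\<partial>\<^sub>k a\<^sub>j)\<close> be the field that
  is projected to give \<open>B(c, a)\<close>.

  The adjoint formula is an integration by parts. Moving one factor around the trace turns
  \<open>m(a\<^sub>j) \<circ> \<partial>\<^sub>j\<close> into multiplication of \<open>\<delta>\<^sub>j\<close> by \<open>a\<^sub>j\<close>, so \<open>t \<circ> D\<^sub>a\<close> vanishes identically when \<open>a\<close> is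
  divergence free (\<open>trace_vderiv\<close>). With the Leibniz rule, \<open>t(D\<^sub>a c\<^sub>k b\<^sub>k) = - t(D\<^sub>a b\<^sub>k c\<^sub>k)\<close>.
  The same rotation shows that \<open>t(m(c)(\<sim>X) b) = t(m(b)(X) c)\<close> (\<open>trace_insert_mult_flip\<close>), so the second part of \<open>V\<close> pairs with \<open>b\<close>
  to \<open>\<Sum>\<^sub>j t(D\<^sub>b a\<^sub>j c\<^sub>j)\<close>. Together \<open>\<langle>V, b\<rangle> = -\<langle>{a, b}, c\<rangle>\<close> (\<open>vscal_transport_adjoint\<close>), and since \<open>b\<close> is
  divergence free, \<open>V\<close> may be replaced by its projection.

  For \<open>c = a\<close> the second part of \<open>V\<close> is the cyclic gradient of \<open>1/2 \<Sum>\<^sub>j a\<^sub>j\<^sup>2\<close>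
  (\<open>cyc_deriv_mult\<close>), which plays the role of the pressure: gradients are orthogonal to divergence
  free fields, so the projection discards it. The orthogonality is in the Hilbert space, where
  one argument is replaced by its adjoint; it holds because \<open>\<delta>\<^sub>j\<close> commutes with the formal
  involution of the free algebra (\<open>cyc_deriv_star\<close>).

  That the projection exists is the projection theorem for closed subspaces of a Hilbert space,
  proved with a minimizing sequence (\<open>exists_closest_point\<close>).
\<close>

section \<open>Orthogonal projections in complex Hilbert spaces\<close>

lemma cinner_add_right: "cinner x (y + z) = cinner x y + cinner x z"
  by (metis cinner_commute cinner_add_left complex_cnj_add)

lemma cinner_scaleC_right: "cinner x (c *\<^sub>C y) = cnj c * cinner x y"
  by (metis cinner_commute cinner_scaleC_left complex_cnj_mult)

lemma cinner_diff_left: "cinner (x - y) z = cinner x z - cinner y z"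
  using cinner_add_left[of "x - y" y z] by simp

text \<open>Reduces complex orthogonality to the underlying real Hilbert space.\<close>

lemma cinner_eq_0_iff_inner: "cinner x y = 0 \<longleftrightarrow> inner x y = 0 \<and> inner (\<i> *\<^sub>C x) y = 0"
  by (simp add: complex_eq_iff inner_eq_Re_cinner cinner_scaleC_left)

lemma cinner_closure_eq_0:
  assumes "\<And>z. z \<in> S \<Longrightarrow> cinner x z = 0" "z \<in> closure S"
  shows "cinner x z = 0"
proof -
  have "closed ({z. inner x z = 0} \<inter> {z. inner (\<i> *\<^sub>C x) z = 0})"
    by (intro closed_Int closed_Collect_eq continuous_intros)
  then have "closure S \<subseteq> {z. inner x z = 0} \<inter> {z. inner (\<i> *\<^sub>C x) z = 0}"
    using assms(1) by (intro closure_minimal) (auto simp: cinner_eq_0_iff_inner)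
  with assms(2) show ?thesis
    by (auto simp: cinner_eq_0_iff_inner)
qed

lemma closure_scaleC_mem:
  assumes "\<And>c x. x \<in> S \<Longrightarrow> c *\<^sub>C x \<in> S" "x \<in> closure S"
  shows "c *\<^sub>C x \<in> closure S"
proof -
  have "(\<lambda>x. c *\<^sub>C x) ` closure S \<subseteq> closure S"
  proof (rule image_closure_subset)
    show "continuous_on (closure S) (\<lambda>x. c *\<^sub>C x)"
      by (rule bounded_linear.continuous_on[OF bounded_linear_scaleC continuous_on_id])
    show "(\<lambda>x. c *\<^sub>C x) ` S \<subseteq> closure S"
      using assms(1) closure_subset by blast
  qed simp
  with assms(2) show ?thesis by blast
qed

lemma closure_subspace:
  fixes S :: "'a::real_normed_vector set"
  assumes "subspace S"
  shows "subspace (closure S)"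
  unfolding subspace_def
proof (intro conjI ballI allI)
  show "0 \<in> closure S"
    using assms closure_subset subspace_0 by blast
next
  fix x y assume "x \<in> closure S" "y \<in> closure S"
  then obtain f g where "\<forall>n. f n \<in> S" "f \<longlonglongrightarrow> x" "\<forall>n. g n \<in> S" "g \<longlonglongrightarrow> y"
    unfolding closure_sequential by blast
  then show "x + y \<in> closure S"
    unfolding closure_sequential using assms
    by (intro exI[of _ "\<lambda>n. f n + g n"]) (auto intro: tendsto_add subspace_add)
next
  fix r :: real and x assume "x \<in> closure S"
  then obtain f where "\<forall>n. f n \<in> S" "f \<longlonglongrightarrow> x"
    unfolding closure_sequential by blast
  then show "r *\<^sub>R x \<in> closure S"
    unfolding closure_sequential using assms
    by (intro exI[of _ "\<lambda>n. r *\<^sub>R f n"]) (auto intro: tendsto_intros subspace_scale)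
qed

lemma parallelogram_law:
  fixes u v :: "'a::real_inner"
  shows "(norm (v - u))\<^sup>2 + (norm (u + v))\<^sup>2 = 2 * (norm u)\<^sup>2 + 2 * (norm v)\<^sup>2"
  by (simp add: power2_norm_eq_inner inner_add inner_diff inner_commute[of v u])

text \<open>
  A minimizing sequence is Cauchy: the midpoint of two of its members again lies in the convex
  set, hence is not closer than the infimum, and the parallelogram law bounds their distance.
\<close>

lemma exists_closest_point:
  fixes S :: "'a::{real_inner, banach} set"
  assumes "closed S" "convex S" "S \<noteq> {}"
  shows "\<exists>y\<in>S. \<forall>z\<in>S. dist x y \<le> dist x z"
proof -
  let ?d = "infdist x S"
  have d: "?d \<le> dist x z" if "z \<in> S" for z
    using that by (rule infdist_le)
  \<comment> \<open>The radii make the squared distances exceed their infimum by at most \<open>1 / (n + 1)\<close>, the form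
    that the parallelogram law needs.\<close>
  have "\<exists>y\<in>S. dist x y < sqrt (?d\<^sup>2 + inverse (Suc n))" for n
  proof -
    have "?d < sqrt (?d\<^sup>2 + inverse (Suc n))"
      by (rule real_less_rsqrt) simp
    then have "(INF z\<in>S. dist x z) < sqrt (?d\<^sup>2 + inverse (Suc n))"
      using assms(3) by (simp add: infdist_notempty)
    moreover have "bdd_below (dist x ` S)"
      by (rule bdd_belowI2[of _ 0]) simp
    ultimately show ?thesis
      using assms(3) by (simp add: cINF_less_iff)
  qed
  then obtain y where y: "\<And>n. y n \<in> S" "\<And>n. dist x (y n) < sqrt (?d\<^sup>2 + inverse (Suc n))"
    by metis
  have sq: "(norm (x - y n))\<^sup>2 \<le> ?d\<^sup>2 + inverse (Suc n)" for n
  proof -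
    have "(dist x (y n))\<^sup>2 \<le> (sqrt (?d\<^sup>2 + inverse (Suc n)))\<^sup>2"
      by (intro power_mono less_imp_le[OF y(2)]) simp
    then show ?thesis by (simp add: dist_norm)
  qed
  have close: "(norm (y m - y n))\<^sup>2 \<le> 2 * inverse (Suc m) + 2 * inverse (Suc n)" for m n
  proof -
    let ?mid = "(1/2) *\<^sub>R y m + (1/2) *\<^sub>R y n"
    have "?mid \<in> S"
      using assms(2) y(1)[of m] y(1)[of n] by (rule convexD) simp_all
    then have "?d\<^sup>2 \<le> (norm (x - ?mid))\<^sup>2"
      unfolding dist_norm[symmetric] by (intro power_mono d infdist_nonneg)
    moreover have "(norm (y m - y n))\<^sup>2 + 4 * (norm (x - ?mid))\<^sup>2 =
        2 * (norm (x - y m))\<^sup>2 + 2 * (norm (x - y n))\<^sup>2"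
    proof -
      have double: "2 *\<^sub>R (x - ?mid) = (x - y m) + (x - y n)"
        by (simp add: scaleR_2 scaleR_right_diff_distrib scaleR_add_right)
      have quad: "4 * (norm (x - ?mid))\<^sup>2 = (norm ((x - y m) + (x - y n)))\<^sup>2"
        unfolding double[symmetric] norm_scaleR by (simp only: power_mult_distrib) simp
      have diff: "(x - y n) - (x - y m) = y m - y n"
        by simp
      show ?thesis
        using parallelogram_law[where u = "x - y m" and v = "x - y n"] unfolding quad diff by linarith
    qed
    ultimately show ?thesis
      using sq[of m] sq[of n] by linarith
  qed
  have "Cauchy y"
  proof (rule metric_CauchyI)
    fix e :: real assume "e > 0"
    then obtain N where N: "inverse (real (Suc N)) < e\<^sup>2 / 4"
      using reals_Archimedean[of "e\<^sup>2 / 4"] by auto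
    have "dist (y m) (y n) < e" if "m \<ge> N" "n \<ge> N" for m n
    proof -
      have "inverse (real (Suc m)) \<le> inverse (real (Suc N))" "inverse (real (Suc n)) \<le> inverse (real (Suc N))"
        using that by (auto intro!: le_imp_inverse_le)
      with close[of m n] N have "(norm (y m - y n))\<^sup>2 < e\<^sup>2"
        by linarith
      then show ?thesis
        unfolding dist_norm using \<open>e > 0\<close> by (rule power_less_imp_less_base[OF _ less_imp_le])
    qed
    then show "\<exists>N. \<forall>m\<ge>N. \<forall>n\<ge>N. dist (y m) (y n) < e" by blast
  qed
  then obtain l where l: "y \<longlonglongrightarrow> l"
    using Cauchy_convergent convergent_def by blast
  have "l \<in> S"
    using assms(1) y(1) l closed_sequentially by blast
  moreover have "dist x l \<le> ?d"
  proof (rule LIMSEQ_le)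
    show "(\<lambda>n. dist x (y n)) \<longlonglongrightarrow> dist x l"
      by (intro tendsto_intros l)
    have "(\<lambda>n. sqrt (?d\<^sup>2 + inverse (real (Suc n)))) \<longlonglongrightarrow> sqrt (?d\<^sup>2 + 0)"
      by (intro tendsto_intros LIMSEQ_inverse_real_of_nat)
    then show "(\<lambda>n. sqrt (?d\<^sup>2 + inverse (real (Suc n)))) \<longlonglongrightarrow> ?d"
      by (simp add: infdist_nonneg)
    show "\<exists>N. \<forall>n\<ge>N. dist x (y n) \<le> sqrt (?d\<^sup>2 + inverse (real (Suc n)))"
      using y(2) less_imp_le by blast
  qed
  ultimately show ?thesis
    using d order_trans by blast
qed

lemma orth_proj_orthogonal:
  fixes S :: "'a::complex_hilbert_space set"
  assumes S: "closed S" "subspace S" and sc: "\<And>c x. x \<in> S \<Longrightarrow> c *\<^sub>C x \<in> S"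
    and "z \<in> S"
  shows "cinner (x - orth_proj S x) z = 0"
proof -
  have conv: "convex S"
    using S(2) by (rule subspace_imp_convex)
  have "S \<noteq> {}"
    using subspace_0[OF S(2)] by blast
  then obtain y where y: "y \<in> S" "\<forall>z\<in>S. dist x y \<le> dist x z"
    using exists_closest_point[OF S(1) conv] by blast
  have le: "inner (x - y) w \<le> 0" if "w \<in> S" for w
    using any_closest_point_dot[OF conv S(1) y(1) _ y(2), of "y + w"] that y(1) S(2)
    by (simp add: subspace_add)
  \<comment> \<open>The subspace contains \<open>w\<close>, \<open>- w\<close> and \<open>\<i> w\<close>; the first two turn the inequality into real
    orthogonality, the third into complex orthogonality.\<close>
  have eq: "inner (x - y) w = 0" if "w \<in> S" for w
    using le[OF that] le[of "- w"] that S(2) by (simp add: subspace_neg)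
  have y0: "cinner (x - y) w = 0" if "w \<in> S" for w
    using eq[OF that] eq[OF sc[OF that, of \<i>]]
    by (simp add: complex_eq_iff inner_eq_Re_cinner cinner_scaleC_right)
  have "orth_proj S x = y"
    unfolding orth_proj_def
  proof (rule the_equality)
    show "y \<in> S \<and> (\<forall>w\<in>S. cinner (x - y) w = 0)"
      using y(1) y0 by blast
  next
    fix y' assume y': "y' \<in> S \<and> (\<forall>w\<in>S. cinner (x - y') w = 0)"
    then have mem: "y' - y \<in> S"
      using y(1) S(2) by (simp add: subspace_diff)
    then have "cinner (y' - y) (y' - y) = 0"
      using y' y0[OF mem] cinner_diff_left[of "x - y" "x - y'" "y' - y"] by simp
    then have "inner (y' - y) (y' - y) = 0"
      by (simp add: inner_eq_Re_cinner)
    then show "y' = y" by simp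
  qed
  with y0 assms(4) show ?thesis by simp
qed

text \<open>The condition that defines the projection of \<open>x\<close> does not see a vector orthogonal to \<open>S\<close>.\<close>

lemma orth_proj_add_orthogonal:
  assumes "\<And>z. z \<in> S \<Longrightarrow> cinner g z = 0"
  shows "orth_proj S (x + g) = orth_proj S x"
proof -
  have "cinner (x + g - y) z = cinner (x - y) z" if "z \<in> S" for y z
    using assms[OF that] cinner_add_left[of "x - y" g z] by (simp add: algebra_simps)
  then show ?thesis
    by (simp add: orth_proj_def cong: conj_cong)
qed


section \<open>Integration by parts for a trace on the free algebra\<close>

lemma nctensor_induct [case_names tensor add]:
  assumes "\<And>P R. Q (tensor P R)" "\<And>X Y. Q X \<Longrightarrow> Q Y \<Longrightarrow> Q (X + Y)"
  shows "Q X"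
proof (induction X rule: pm_induct)
  case (single w e)
  have "Poly_Mapping.single w e =
      tensor (Poly_Mapping.single (fst w) e) (Poly_Mapping.single (snd w) 1)"
    by (simp add: tensor_single)
  then show ?case
    using assms(1) by simp
qed (rule assms(2))

lemma tensor_mult: "tensor P Q * tensor P' Q' = tensor (P * P') (Q * Q')"
proof (induction P rule: pm_induct)
  case (single u c)
  show ?case
  proof (induction Q rule: pm_induct)
    case (single v d)
    show ?case
    proof (induction P' rule: pm_induct)
      case (single u' c')
      show ?case
        by (induction Q' rule: pm_induct)
          (simp_all add: tensor_single mult_single tensor_add_right distrib_left ac_simps)
    qed (simp add: tensor_add_left distrib_left)
  qed (simp add: tensor_add_right distrib_right)
qed (simp add: tensor_add_left distrib_right)

lemma cyc_deriv_add: "cyc_deriv j (P + Q) = cyc_deriv j P + cyc_deriv j Q"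
  by (simp add: cyc_deriv_def fdq_add flip_add mult_map_add)

text \<open>
  For \<open>\<partial>\<^sub>k Q = \<Sum> X \<otimes> Y\<close> the contribution of \<open>P \<partial>\<^sub>k Q\<close> is \<open>\<Sum> Y P X\<close>: the other factor is inserted
  where the flipped tensor is open.
\<close>

lemma cyc_deriv_mult:
  "cyc_deriv k (P * Q) = insert_mult P (flip (fdq k Q)) + insert_mult Q (flip (fdq k P))"
proof -
  have "mult_map (flip (tensor P 1 * X)) = insert_mult P (flip X)" for X
    by (induction X rule: nctensor_induct)
      (simp_all add: tensor_mult flip_tensor mult_map_tensor insert_mult_tensor mult.assoc
        distrib_left flip_add mult_map_add insert_mult_add)
  moreover have "mult_map (flip (X * tensor 1 Q)) = insert_mult Q (flip X)" for X
    by (induction X rule: nctensor_induct)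
      (simp_all add: tensor_mult flip_tensor mult_map_tensor insert_mult_tensor
        distrib_right flip_add mult_map_add insert_mult_add)
  ultimately show ?thesis
    by (simp add: cyc_deriv_def fdq_mult flip_add mult_map_add)
qed

context
  fixes t :: "'n::finite ncpoly \<Rightarrow> complex"
  assumes additive: "Modules.additive t" and trace: "\<And>P Q. t (P * Q) = t (Q * P)"
begin

lemma trace_insert_mult: "t (insert_mult b X) = t (b * mult_map (flip X))"
proof (induction X rule: nctensor_induct)
  case (tensor P R)
  show ?case
    using trace[of P "b * R"] by (simp add: insert_mult_tensor flip_tensor mult_map_tensor mult.assoc)
qed (simp add: insert_mult_add flip_add mult_map_add distrib_left Modules.additive.add[OF additive])

lemma trace_vderiv: "t (vderiv P R) = (\<Sum>j\<in>UNIV. t (P $ j * cyc_deriv j R))"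
  by (simp add: vderiv_def Modules.additive.sum[OF additive] trace_insert_mult cyc_deriv_def)

lemma trace_insert_mult_flip: "t (insert_mult c (flip X) * b) = t (insert_mult b X * c)"
proof (induction X rule: nctensor_induct)
  case (tensor P R)
  show ?case
    using trace[of "R * c" "P * b"] by (simp add: insert_mult_tensor flip_tensor mult.assoc)
qed (simp add: insert_mult_add flip_add distrib_right Modules.additive.add[OF additive])

text \<open>
  The two correction terms come from the Leibniz rule for \<open>D\<^sub>a\<close> under the trace, where the total
  derivative integrates to zero, and from exchanging the roles of \<open>c\<^sub>j\<close> and \<open>b\<^sub>k\<close>.
\<close>

lemma trace_transport_adjoint:
  assumes df: "\<And>R. (\<Sum>j\<in>UNIV. t (a $ j * cyc_deriv j R)) = 0"
  shows "(\<Sum>k\<in>UNIV. t ((vderiv a (c $ k) + (\<Sum>j\<in>UNIV. insert_mult (c $ j) (flip (fdq k (a $ j))))) * b $ k))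
    = - (\<Sum>k\<in>UNIV. t (bracket a b $ k * c $ k))"
proof -
  interpret Modules.additive t by (rule additive)
  have "t (vderiv a (c $ k * b $ k)) = 0" for k
    using df by (simp add: trace_vderiv)
  then have leibniz: "t (vderiv a (c $ k) * b $ k) = - t (vderiv a (b $ k) * c $ k)" for k
    by (simp add: vderiv_mult add trace[of "c $ k"] add_eq_0_iff)
  have "(\<Sum>k\<in>UNIV. t ((\<Sum>j\<in>UNIV. insert_mult (c $ j) (flip (fdq k (a $ j)))) * b $ k)) =
      (\<Sum>k\<in>UNIV. \<Sum>j\<in>UNIV. t (insert_mult (b $ k) (fdq k (a $ j)) * c $ j))"
    by (simp add: sum_distrib_right sum trace_insert_mult_flip)
  also have "\<dots> = (\<Sum>j\<in>UNIV. t (vderiv b (a $ j) * c $ j))"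
    by (subst sum.swap) (simp add: vderiv_def sum_distrib_right sum)
  finally have "(\<Sum>k\<in>UNIV. t ((\<Sum>j\<in>UNIV. insert_mult (c $ j) (flip (fdq k (a $ j)))) * b $ k)) =
      (\<Sum>j\<in>UNIV. t (vderiv b (a $ j) * c $ j))" .
  then show ?thesis
    by (simp add: distrib_right left_diff_distrib add diff leibniz bracket_def sum.distrib
        sum_negf sum_subtractf)
qed

end


section \<open>The formal involution\<close>

text \<open>
  The conjugate-linear anti-automorphism of the free algebra that fixes the generators. Evaluation
  at self-adjoint operators carries it to the Hilbert space adjoint.
\<close>

definition nc_star :: "'i ncpoly \<Rightarrow> 'i ncpoly" where
  "nc_star P = (\<Sum>w\<in>Poly_Mapping.keys P.
     Poly_Mapping.single (Word (rev (letters w))) (cnj (Poly_Mapping.lookup P w)))"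

lemma nc_star_single:
  "nc_star (Poly_Mapping.single w c) = Poly_Mapping.single (Word (rev (letters w))) (cnj c)"
  by (cases "c = 0") (simp_all add: nc_star_def)

lemma nc_star_add: "nc_star (P + Q) = nc_star P + nc_star Q"
  unfolding nc_star_def
  by (rule setsum_keys_plus_distrib) (simp_all add: single_add)

text \<open>
  Reversal sends the letter at position \<open>k\<close> to position \<open>length w - Suc k\<close> and exchanges the
  pieces before and after it, so it permutes the cyclic rotations that make up the derivative.
\<close>

lemma cyc_deriv_star: "cyc_deriv j (nc_star P) = nc_star (cyc_deriv j P)"
proof (induction P rule: pm_induct)
  case (single u c)
  obtain w where u: "u = Word w" by (cases u)
  let ?n = "length w"
  have star_sum: "nc_star (sum f A) = (\<Sum>k\<in>A. nc_star (f k))" for f :: "nat \<Rightarrow> 'a ncpoly" and A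
    by (rule Modules.additive.sum) (simp add: Modules.additive_def nc_star_add)
  have "(\<Sum>k | k < ?n \<and> rev w ! k = j.
        Poly_Mapping.single (Word (drop (Suc k) (rev w) @ take k (rev w))) (cnj c)) =
      (\<Sum>k | k < ?n \<and> w ! k = j.
        Poly_Mapping.single (Word (rev (drop (Suc k) w @ take k w))) (cnj c))"
    by (rule sum.reindex_bij_witness[where i = "\<lambda>k. ?n - Suc k" and j = "\<lambda>k. ?n - Suc k"])
      (auto simp: rev_nth take_rev drop_rev Suc_diff_Suc)
  then show ?case
    by (simp add: u nc_star_single cyc_deriv_word star_sum)
qed (simp add: nc_star_add cyc_deriv_add)

lemma cinner_evalp_star:
  assumes s: "\<And>j. bounded_clinear (s j)" and sa: "\<And>j. self_adjoint (s j)"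
  shows "cinner (evalp s P x) y = cinner x (evalp s (nc_star P) y)"
proof (induction P rule: pm_induct)
  case (single u c)
  have "cinner (evalp s (Poly_Mapping.single (Word w) c) x) y =
      cinner x (evalp s (Poly_Mapping.single (Word (rev w)) (cnj c)) y)" for w x y
  proof (induction w arbitrary: y)
    case Nil
    show ?case by (simp add: evalp_single cinner_scaleC_left cinner_scaleC_right)
  next
    case (Cons i w)
    have "Poly_Mapping.single (Word (i # w)) c = gen i * Poly_Mapping.single (Word w) c"
      "Poly_Mapping.single (Word (rev (i # w))) (cnj c) =
        Poly_Mapping.single (Word (rev w)) (cnj c) * gen i"
      by (simp_all add: gen_def mult_single plus_free_monoid_def)
    then show ?case
      using Cons sa[of i] by (simp add: evalp_mult[of s, OF s] evalp_gen self_adjoint_def)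
  qed
  from this[of "letters u"] show ?case
    by (simp add: nc_star_single)
next
  case (add P Q)
  then show ?case
    by (simp add: evalp_add nc_star_add cinner_add_left cinner_add_right)
qed

lemma hadjoint_unique:
  assumes "\<And>x y. cinner (T x) y = cinner x (S y)"
  shows "hadjoint T = S"
  unfolding hadjoint_def
proof (rule the_equality)
  fix S' assume S': "\<forall>x y. cinner (T x) y = cinner x (S' y)"
  show "S' = S"
  proof (rule ext)
    fix y
    have "cinner x (S' y) = cinner x (S y)" for x
      using S' assms by metis
    then have "inner x (S' y) = inner x (S y)" for x
      by (simp add: inner_eq_Re_cinner)
    then show "S' y = S y"
      by (metis vector_eq_ldot)
  qed
qed (simp add: assms)


section \<open>Vector fields in the Hilbert space of the trace\<close>

context
  fixes M :: "('h::complex_hilbert_space \<Rightarrow> 'h) set"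
    and \<tau> :: "('h \<Rightarrow> 'h) \<Rightarrow> complex"
    and s :: "'n::finite \<Rightarrow> 'h \<Rightarrow> 'h"
    and \<eta> :: "('h \<Rightarrow> 'h) \<Rightarrow> 'k::complex_hilbert_space"
  assumes M: "M = W_star (range s)" and tau: "tracial_state M \<tau>"
    and semi: "semicircular_system \<tau> s" and L2: "L2_space M \<tau> \<eta>"
begin

lemma semicircular_bounded: "bounded_clinear (s j)"
  using semi by (simp add: semicircular_system_def)

lemma evalp_mem: "evalp s P \<in> M"
  unfolding M by (rule evalp_in_W_star) (rule semicircular_bounded)

lemma evalp_times: "evalp s (P * Q) = evalp s P \<circ> evalp s Q"
  by (rule evalp_mult) (rule semicircular_bounded)

lemma additive_trace_evalp: "Modules.additive (\<lambda>P. \<tau> (evalp s P))"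
proof
  fix P Q
  have "evalp s (P + Q) = (\<lambda>x. evalp s P x + evalp s Q x)"
    by (rule ext) (rule evalp_add)
  then show "\<tau> (evalp s (P + Q)) = \<tau> (evalp s P) + \<tau> (evalp s Q)"
    using tau evalp_mem by (simp add: tracial_state_def)
qed

lemma trace_evalp_commute: "\<tau> (evalp s (P * Q)) = \<tau> (evalp s (Q * P))"
  unfolding evalp_times using tau evalp_mem unfolding tracial_state_def by blast

lemma vscal_transport_adjoint:
  assumes "a \<in> Vect_df \<tau> s"
  shows "vscal \<tau> s (\<chi> k. vderiv a (c $ k) + (\<Sum>j\<in>UNIV. insert_mult (c $ j) (flip (fdq k (a $ j))))) b
    = - vscal \<tau> s (bracket a b) c"
  using trace_transport_adjoint[OF additive_trace_evalp trace_evalp_commute, of a c b] assms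
  by (simp add: vscal_def Vect_df_def)

lemma hadjoint_evalp: "hadjoint (evalp s P) = evalp s (nc_star P)"
  using semi
  by (intro hadjoint_unique cinner_evalp_star semicircular_bounded)
    (simp add: semicircular_system_def semicircular_def)

lemma cinner_L2_evalp: "cinner (\<eta> (evalp s P)) (\<eta> (evalp s Q)) = \<tau> (evalp s (nc_star Q * P))"
  using L2 evalp_mem by (simp add: L2_space_def hadjoint_evalp evalp_times)

lemma L2_vect_add: "L2_vect \<eta> s (P + Q) = L2_vect \<eta> s P + L2_vect \<eta> s Q"
proof -
  have "evalp s (P $ j + Q $ j) = (\<lambda>x. evalp s (P $ j) x + evalp s (Q $ j) x)" for j
    by (rule ext) (rule evalp_add)
  then show ?thesis
    using L2 evalp_mem by (simp add: L2_vect_def L2_space_def vec_eq_iff)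
qed

text \<open>
  The adjoint of \<open>\<delta>\<^sub>j R\<close> is again a cyclic derivative, that of \<open>R\<^sup>*\<close>. So the bilinear condition in the
  definition of divergence free fields, tested on \<open>R\<^sup>*\<close>, is sesquilinear orthogonality to the
  gradient of \<open>R\<close>, also for fields \<open>P\<close> that are not self-adjoint.
\<close>

lemma cyc_gradient_orthogonal:
  assumes "P \<in> Vect_df \<tau> s"
  shows "cinner (L2_vect \<eta> s (\<chi> j. cyc_deriv j R)) (L2_vect \<eta> s P) = 0"
proof -
  have "cinner (L2_vect \<eta> s P) (L2_vect \<eta> s (\<chi> j. cyc_deriv j R)) =
      (\<Sum>j\<in>UNIV. \<tau> (evalp s (P $ j * cyc_deriv j (nc_star R))))"
    by (simp add: cinner_vec_def L2_vect_def cinner_L2_evalp cyc_deriv_star trace_evalp_commute[of "P $ _"])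
  also have "\<dots> = 0"
    using assms by (simp add: Vect_df_def)
  finally show ?thesis
    by (metis cinner_commute complex_cnj_zero)
qed

lemma evalp_scalar: "evalp s (Poly_Mapping.single 0 c * P) = (\<lambda>x. c *\<^sub>C evalp s P x)"
  by (rule ext) (simp add: evalp_times evalp_single zero_free_monoid_def)

lemma Vect_df_image_scaleC:
  assumes "x \<in> L2_vect \<eta> s ` Vect_df \<tau> s"
  shows "c *\<^sub>C x \<in> L2_vect \<eta> s ` Vect_df \<tau> s"
proof -
  obtain P where P: "P \<in> Vect_df \<tau> s" "x = L2_vect \<eta> s P"
    using assms by blast
  let ?P = "(\<chi> j. Poly_Mapping.single 0 c * P $ j) :: 'n vect"
  have "\<tau> (evalp s (Poly_Mapping.single 0 c * P $ j * R)) = c * \<tau> (evalp s (P $ j * R))" for j R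
    using tau evalp_mem by (simp add: mult.assoc evalp_scalar tracial_state_def)
  then have "?P \<in> Vect_df \<tau> s"
    using P(1) by (simp add: Vect_df_def flip: sum_distrib_left)
  moreover have "c *\<^sub>C x = L2_vect \<eta> s ?P"
    using L2 evalp_mem by (simp add: P(2) L2_vect_def scaleC_vec_def evalp_scalar L2_space_def)
  ultimately show ?thesis by blast
qed

lemma Vect_df_image_subspace: "subspace (L2_vect \<eta> s ` Vect_df \<tau> s)"
  unfolding subspace_def
proof (intro conjI ballI allI)
  interpret Modules.additive "\<lambda>P. \<tau> (evalp s P)" by (rule additive_trace_evalp)
  have "(0 :: 'n vect) \<in> Vect_df \<tau> s"
    using zero by (simp add: Vect_df_def)
  then have "0 *\<^sub>C L2_vect \<eta> s 0 \<in> L2_vect \<eta> s ` Vect_df \<tau> s"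
    by (intro Vect_df_image_scaleC imageI)
  then show "0 \<in> L2_vect \<eta> s ` Vect_df \<tau> s"
    by (simp add: scaleC_zero_left)
next
  interpret Modules.additive "\<lambda>P. \<tau> (evalp s P)" by (rule additive_trace_evalp)
  fix x y assume "x \<in> L2_vect \<eta> s ` Vect_df \<tau> s" "y \<in> L2_vect \<eta> s ` Vect_df \<tau> s"
  then obtain P Q where "P \<in> Vect_df \<tau> s" "x = L2_vect \<eta> s P" "Q \<in> Vect_df \<tau> s" "y = L2_vect \<eta> s Q"
    by blast
  then have "P + Q \<in> Vect_df \<tau> s" "x + y = L2_vect \<eta> s (P + Q)"
    by (simp_all add: Vect_df_def distrib_right add sum.distrib L2_vect_add)
  then show "x + y \<in> L2_vect \<eta> s ` Vect_df \<tau> s"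
    by blast
next
  fix r :: real and x assume "x \<in> L2_vect \<eta> s ` Vect_df \<tau> s"
  then show "r *\<^sub>R x \<in> L2_vect \<eta> s ` Vect_df \<tau> s"
    using Vect_df_image_scaleC[of x "complex_of_real r"] by (simp add: scaleC_of_real)
qed

lemma leray_orthogonal:
  assumes "P \<in> Vect_df \<tau> s"
  shows "cinner (x - leray \<tau> \<eta> s x) (L2_vect \<eta> s P) = 0"
  unfolding leray_def
proof (rule orth_proj_orthogonal)
  show "subspace (closure (L2_vect \<eta> s ` Vect_df \<tau> s))"
    by (intro closure_subspace Vect_df_image_subspace)
  show "c *\<^sub>C y \<in> closure (L2_vect \<eta> s ` Vect_df \<tau> s)"
    if "y \<in> closure (L2_vect \<eta> s ` Vect_df \<tau> s)" for c y
    using Vect_df_image_scaleC that by (rule closure_scaleC_mem)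
  show "L2_vect \<eta> s P \<in> closure (L2_vect \<eta> s ` Vect_df \<tau> s)"
    by (intro subsetD[OF closure_subset] imageI assms)
qed simp

lemma euler_B_adjoint:
  assumes "a \<in> Vect_df \<tau> s" "b \<in> Vect_df_sa \<tau> s"
  shows "cinner (euler_B \<tau> \<eta> s c a) (L2_vect \<eta> s b) = - vscal \<tau> s (bracket a b) c"
proof -
  let ?V = "(\<chi> k. vderiv a (c $ k) + (\<Sum>j\<in>UNIV. insert_mult (c $ j) (flip (fdq k (a $ j))))) :: 'n vect"
  have b: "b \<in> Vect_df \<tau> s" "\<And>j. self_adjoint (evalp s (b $ j))"
    using assms(2) by (auto simp: Vect_df_sa_def)
  have "cinner (euler_B \<tau> \<eta> s c a) (L2_vect \<eta> s b) = cinner (L2_vect \<eta> s ?V) (L2_vect \<eta> s b)"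
    using leray_orthogonal[OF b(1), of "L2_vect \<eta> s ?V"] by (simp add: euler_B_def cinner_diff_left)
  also have "\<dots> = vscal \<tau> s ?V b"
    using M tau semi L2 b(2) by (rule cinner_L2_vect)
  also have "\<dots> = - vscal \<tau> s (bracket a b) c"
    using assms(1) by (rule vscal_transport_adjoint)
  finally show ?thesis .
qed

text \<open>
  For \<open>R = \<Sum>\<^sub>j a\<^sub>j\<^sup>2\<close> the two halves of \<open>cyc_deriv_mult\<close> coincide, so the second part of the field is
  half the cyclic gradient of \<open>R\<close>, and the projection annihilates it.
\<close>

lemma euler_B_diagonal:
  "euler_B \<tau> \<eta> s a a = leray \<tau> \<eta> s (L2_vect \<eta> s (\<chi> k. vderiv a (a $ k)))"
proof -
  let ?G = "(\<chi> k. \<Sum>j\<in>UNIV. insert_mult (a $ j) (flip (fdq k (a $ j)))) :: 'n vect"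
  have "cyc_deriv k (\<Sum>j\<in>UNIV. a $ j * a $ j) = ?G $ k + ?G $ k" for k
    by (subst Modules.additive.sum[of "cyc_deriv k"])
      (simp_all add: Modules.additive_def cyc_deriv_add cyc_deriv_mult sum.distrib)
  then have "?G + ?G = (\<chi> k. cyc_deriv k (\<Sum>j\<in>UNIV. a $ j * a $ j))"
    by (simp add: vec_eq_iff)
  then have "cinner (L2_vect \<eta> s (?G + ?G)) (L2_vect \<eta> s P) = 0" if "P \<in> Vect_df \<tau> s" for P
    using that by (simp only: cyc_gradient_orthogonal)
  then have "cinner (L2_vect \<eta> s ?G) (L2_vect \<eta> s P) = 0" if "P \<in> Vect_df \<tau> s" for P
    using that by (simp add: L2_vect_add cinner_add_left)
  then have orth: "cinner (L2_vect \<eta> s ?G) z = 0" if "z \<in> closure (L2_vect \<eta> s ` Vect_df \<tau> s)" for z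
    using that by (intro cinner_closure_eq_0[OF _ that]) auto
  have "(\<chi> k. vderiv a (a $ k) + (\<Sum>j\<in>UNIV. insert_mult (a $ j) (flip (fdq k (a $ j))))) =
      (\<chi> k. vderiv a (a $ k)) + ?G"
    by (simp add: vec_eq_iff)
  then show ?thesis
    unfolding euler_B_def leray_def by (simp only: L2_vect_add orth_proj_add_orthogonal[OF orth])
qed

lemma vscal_uminus_left: "vscal \<tau> s (- P) Q = - vscal \<tau> s P Q"
  using Modules.additive.minus[OF additive_trace_evalp] by (simp add: vscal_def sum_negf)

end

theorem lemma1:
  fixes M :: "('h::complex_hilbert_space \<Rightarrow> 'h) set"
    and \<tau> :: "('h \<Rightarrow> 'h) \<Rightarrow> complex"
    and s :: "'n::finite \<Rightarrow> 'h \<Rightarrow> 'h"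
    and \<eta> :: "('h \<Rightarrow> 'h) \<Rightarrow> 'k::complex_hilbert_space"
    and a b c :: "'n vect"
  assumes "M = W_star (range s)"
    and "tracial_state M \<tau>" "faithful M \<tau>" "normal M \<tau>"
    and "semicircular_system \<tau> s"
    and "L2_space M \<tau> \<eta>"
    and "a \<in> Vect_df_sa \<tau> s" "b \<in> Vect_df_sa \<tau> s" "c \<in> Vect_df_sa \<tau> s"
  shows "- vscal \<tau> s (bracket a b) c = cinner (euler_B \<tau> \<eta> s c a) (L2_vect \<eta> s b)
       \<and> vscal \<tau> s (commutator a b) c = cinner (euler_B \<tau> \<eta> s c a) (L2_vect \<eta> s b)
       \<and> euler_B \<tau> \<eta> s a a = leray \<tau> \<eta> s (L2_vect \<eta> s (\<chi> k. vderiv a (a $ k)))"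
  using assms euler_B_adjoint[OF assms(1,2,5,6), of a b c] euler_B_diagonal[OF assms(1,2,5,6), of a]
    vscal_uminus_left[OF assms(1,2,5,6), of "bracket a b" c]
  by (simp add: commutator_def Vect_df_sa_def)

end
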